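(* For every integer $n\geqslant 1$ and every integer $k\geqslant 0$, the type $D$ Eulerian numbers satisfy $$ \begin{aligned} D_{n+2,k}=\;&(n+4k)D_{n+1,k}+(5n-4k+8)D_{n+1,k-1}\\ &+[(1-n)-4(1+n)k-4k(k-1)]D_{n,k}\\ &+[-2(1+n+2n^2)+8(1-n)(k-1)+8(k-1)(k-2)]D_{n,k-1}\\ &+[(1-n-8n^2)-4(1-3n)(k-2)-4(k-2)(k-3)]D_{n,k-2}\\ &+[6nk+4nk(k-1)]D_{n-1,k}\\ &+[6n(n-1)+2n(4n-9)(k-1)-4n(k-1)(k-2)]D_{n-1,k-1}\\ &+[4n(n-1)^2+2n(k-2)-4n(k-2)(k-3)]D_{n-1,k-2}\\ &+[2n(1-3n+2n^2)+2n(5-4n)(k-3)+4n(k-3)(k-4)]D_{n-1,k-3}. \end{aligned} $$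
   Context: $B_n$ is the group of signed permutations $\pi=\pi_1\pi_2\cdots\pi_n$ of $\{1,\dots,n\}$ (so $|\pi_1|\cdots|\pi_n|$ is a permutation of $1,\dots,n$), and $D_n\subset B_n$ is the subgroup (Coxeter group of type $D$) of those with an even number of negative entries. For $n\geqslant 2$, an index $i\in\{0,1,\dots,n-1\}$ is a ($D$-)descent of $\pi$ if $\pi_i>\pi_{i+1}$, where $\pi_0:=-\pi_2$. For $n\geqslant 2$ the Eulerian number $D_{n,k}$ of type $D$ is the number of elements of $D_n$ with exactly $k$ descents. For $n=0,1$ the convention is $D_0(t)=D_1(t)=1$ for the polynomial $D_n(t)=\sum_k D_{n,k}t^k$, i.e. $D_{0,0}=D_{1,0}=1$ and $D_{0,k}=D_{1,k}=0$ for $k\neq 0$. Also $D_{n,k}=0$ whenever $k<0$ or $k>n$. *)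

theory Defs
  imports Complex_Main "HOL-Combinatorics.Multiset_Permutations"
begin

(* Signed permutations in one-line notation: the list [w_1, ..., w_n], where
   |w_1|, ..., |w_n| is a permutation of 1, ..., n. *)
definition signed_perms :: "nat \<Rightarrow> int list set" where
  "signed_perms n = {w. map abs w \<in> permutations_of_set {1..int n}}"

definition even_signed_perms :: "nat \<Rightarrow> int list set" where
  "even_signed_perms n = {w \<in> signed_perms n. even (card {i. i < length w \<and> w ! i < 0})}"

(* The entry w_i with the type D convention w_0 = - w_2. Lists are indexed from 0,
   so w_i is w ! (i - 1) and w_2 is w ! 1; only meaningful for length at least 2. *)
definition entry_D :: "int list \<Rightarrow> nat \<Rightarrow> int" where
  "entry_D w i = (if i = 0 then - (w ! 1) else w ! (i - 1))"

definition descents_D :: "int list \<Rightarrow> nat set" where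
  "descents_D w = {i. i < length w \<and> entry_D w i > entry_D w (i + 1)}"

(* The lower index is an integer, so that the numbers with a negative index are 0. *)
definition eulerian_D :: "nat \<Rightarrow> int \<Rightarrow> int" where
  "eulerian_D n k =
     (if n < 2 then (if k = 0 then 1 else 0)
      else int (card {w \<in> even_signed_perms n. int (card (descents_D w)) = k}))"

lemma length_signed_perms: "w \<in> signed_perms n \<Longrightarrow> length w = n"
  by (auto simp: signed_perms_def dest!: length_finite_permutations_of_set)

lemma eulerian_D_neg: "k < 0 \<Longrightarrow> eulerian_D n k = 0"
  by (auto simp: eulerian_D_def)

lemma eulerian_D_gt:
  assumes "k > int n"
  shows "eulerian_D n k = 0"
proof -
  have "int (card (descents_D w)) \<noteq> k" if "w \<in> even_signed_perms n" for w
  proof -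
    have "length w = n"
      using that by (simp add: even_signed_perms_def length_signed_perms)
    moreover have "card (descents_D w) \<le> length w"
      using card_mono[of "{..<length w}" "descents_D w"] by (auto simp: descents_D_def)
    ultimately show ?thesis using assms by linarith
  qed
  then have "{w \<in> even_signed_perms n. int (card (descents_D w)) = k} = {}"
    by blast
  then show ?thesis using assms by (simp only: eulerian_D_def card.empty) simp
qed

end

theory Submission
  imports Defs
begin

text \<open>
  Write \<open>B(n,k)\<close> for the type B Eulerian numbers and \<open>F(n,k)\<close> for the number of signed
  permutations of \<open>1, \<dots>, n\<close> with exactly \<open>k\<close> ordinary descents, that is, descents at a position
  between two entries. In terms of the classical Eulerian numbers, \<open>F(n,k) = 2\<^sup>n A(n,k)\<close>. The proof
  rests on Stembridge's identity \<open>D(n,k) = B(n,k) - n F(n-1,k-1)\<close> (lemma \<open>eulerian_D_eq\<close>), which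
  replaces the type D numbers by two families, each of which satisfies a two-term
  recurrence.

  Stembridge's identity comes from two involutions on signed permutations. Changing the sign of
  the entry \<open>1\<close> or \<open>-1\<close> preserves the D-descents, because it changes no comparison between
  entries of distinct absolute value, and it changes the parity of the number of negative entries.
  Hence \<open>2 D(n,k)\<close> counts all signed permutations by their D-descents (lemma \<open>two_eulerian_D\<close>).
  Changing the sign of the first entry pairs \<open>w\<close> with some \<open>w'\<close>, and a look at the first two entries
  shows, with \<open>des\<close> the number of ordinary descents, that
  \<open>2 (t^des\<^sub>B(w) + t^des\<^sub>B(w')) - (t^des\<^sub>D(w) + t^des\<^sub>D(w')) = 2 t t^des(w\<^sub>2 \<dots> w\<^sub>n)\<close>
  (lemma \<open>descents_flip_hd\<close>). Summing over all pairs gives \<open>2 B - 2 D\<close> on the left, and on the right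
  a sum over the \<open>2n\<close> possible first entries and the signed arrangements of the remaining values.

  The two-term recurrences of \<open>B\<close> and \<open>F\<close> come from inserting the entry of largest absolute value,
  with either sign, into a shorter signed arrangement. They express every number
  in the claimed recurrence through those at the lowest level, and the recurrence then holds for
  \<open>B(n,k)\<close> and for \<open>n F(n-1,k-1)\<close> separately, as an identity between polynomials in \<open>n\<close> and \<open>k\<close>
  in front of each lowest-level term. As the recurrence is linear, it holds for the difference.
\<close>

section \<open>Descents of lists and insertion of a dominating entry\<close>

text \<open>
  Descents between neighbouring entries only. The type B and D statistics of \<open>w\<close> are those of
  \<open>0 # w\<close> and \<open>- w\<^sub>2 # w\<close>. The values are integers because the Eulerian numbers have an
  integer index.
\<close>
fun des :: "'a::linorder list \<Rightarrow> int" where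
  "des [] = 0"
| "des [x] = 0"
| "des (x # y # zs) = of_bool (y < x) + des (y # zs)"

lemma card_descents_eq_des: "int (card {i. Suc i < length xs \<and> xs ! Suc i < xs ! i}) = des xs"
proof (induction xs rule: des.induct)
  case (3 x y zs)
  let ?D = "\<lambda>xs. {i. Suc i < length xs \<and> xs ! Suc i < xs ! i}"
  have "?D (x # y # zs) = (if y < x then {0} else {}) \<union> Suc ` ?D (y # zs)"
  proof (rule set_eqI)
    show "i \<in> ?D (x # y # zs) \<longleftrightarrow> i \<in> (if y < x then {0} else {}) \<union> Suc ` ?D (y # zs)" for i
      by (cases i) auto
  qed
  moreover have "finite (?D (y # zs))"
    by (rule finite_subset[of _ "{..<length (y # zs)}"]) auto
  ultimately have "card (?D (x # y # zs)) = of_bool (y < x) + card (?D (y # zs))"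
    by (subst \<open>?D (x # y # zs) = _\<close>, subst card_Un_disjoint) (auto simp: card_image)
  then show ?case
    using 3 by simp
qed simp_all

text \<open>
  A maximal entry inserted into a descent or at the end keeps the number of descents; inserted
  into an ascent, it adds one. With \<open>d\<close> descents in \<open>x # w\<close>, this gives \<open>d + 1\<close> insertions of
  the first kind and \<open>length w - d\<close> of the second. The factors are written in terms of \<open>k\<close>, which
  is \<open>d\<close> in the first summand and \<open>d + 1\<close> in the second.
\<close>
lemma sum_insert_greater:
  fixes x m :: "'a::linorder"
  assumes "x < m" "\<forall>y \<in> set w. y < m"
  shows "(\<Sum>i\<le>length w. of_bool (des (x # take i w @ m # drop i w) = k)) =
    (k + 1) * of_bool (des (x # w) = k) + (int (length w) - k + 1) * of_bool (des (x # w) = k - 1)"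
  using assms
proof (induction w arbitrary: x k)
  case Nil
  then show ?case by (auto simp: of_bool_def)
next
  case (Cons y w)
  have "(\<Sum>i\<le>length w. of_bool (des (x # take (Suc i) (y # w) @ m # drop (Suc i) (y # w)) = k)) =
      (\<Sum>i\<le>length w. of_bool (des (y # take i w @ m # drop i w) = k - of_bool (y < x)) :: int)"
    by (intro sum.cong) (auto simp: algebra_simps)
  then show ?case
    using Cons.prems Cons.IH[of y "k - of_bool (y < x)"]
    by (auto simp: sum.atMost_Suc_shift simp del: sum.atMost_Suc)
qed

text \<open>
  The only difference for a minimal entry is at the end of the list, where it adds a descent.
\<close>
lemma sum_insert_less:
  fixes x m :: "'a::linorder"
  assumes "m < x" "\<forall>y \<in> set w. m < y"
  shows "(\<Sum>i\<le>length w. of_bool (des (x # take i w @ m # drop i w) = k)) =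
    k * of_bool (des (x # w) = k) + (int (length w) - k + 2) * of_bool (des (x # w) = k - 1)"
  using assms
proof (induction w arbitrary: x k)
  case Nil
  then show ?case by (auto simp: of_bool_def)
next
  case (Cons y w)
  have "(\<Sum>i\<le>length w. of_bool (des (x # take (Suc i) (y # w) @ m # drop (Suc i) (y # w)) = k)) =
      (\<Sum>i\<le>length w. of_bool (des (y # take i w @ m # drop i w) = k - of_bool (y < x)) :: int)"
    by (intro sum.cong) (auto simp: algebra_simps)
  then show ?case
    using Cons.prems Cons.IH[of y "k - of_bool (y < x)"]
    by (auto simp: sum.atMost_Suc_shift simp del: sum.atMost_Suc)
qed

section \<open>Signed arrangements of a finite set\<close>

text \<open>
  Arbitrary sets of absolute values are allowed since deleting the first entry of a signed
  permutation leaves an arrangement of a set with a gap.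
\<close>
definition signed_lists :: "int set \<Rightarrow> int list set" where
  "signed_lists T = {w. map abs w \<in> permutations_of_set T}"

lemma signed_listsI: "distinct (map abs w) \<Longrightarrow> abs ` set w = T \<Longrightarrow> w \<in> signed_lists T"
  by (auto simp: signed_lists_def permutations_of_set_def)

lemma signed_listsD:
  assumes "w \<in> signed_lists T"
  shows "distinct (map abs w)" "abs ` set w = T" "length w = card T"
  using assms distinct_card[of "map abs w"]
  by (auto simp: signed_lists_def permutations_of_set_def)

lemma signed_lists_empty: "signed_lists {} = {[]}"
  by (auto simp: signed_lists_def)

lemma finite_signed_lists: "finite T \<Longrightarrow> finite (signed_lists T)"
proof (rule finite_subset)
  assume "finite T"
  then show "finite {w. set w \<subseteq> T \<union> uminus ` T \<and> length w = card T}"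
    by (intro finite_lists_length_eq) auto
  show "signed_lists T \<subseteq> {w. set w \<subseteq> T \<union> uminus ` T \<and> length w = card T}"
  proof clarsimp
    fix w assume w: "w \<in> signed_lists T"
    have "x \<in> T \<union> uminus ` T" if "x \<in> set w" for x
    proof -
      have "\<bar>x\<bar> \<in> T" using that signed_listsD(2)[OF w] by blast
      then show ?thesis by (cases "x \<ge> 0") (auto simp: image_iff intro: bexI[of _ "-x"])
    qed
    then show "set w \<subseteq> T \<union> uminus ` T \<and> length w = card T"
      using signed_listsD(3)[OF w] by blast
  qed
qed

text \<open>
  A signed arrangement of \<open>insert m T\<close> is determined by the arrangement of \<open>T\<close> left after deleting
  the entry of absolute value \<open>m\<close>, together with the position and the sign of that entry.
\<close>
lemma sum_signed_lists_insert:
  fixes f :: "int list \<Rightarrow> int"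
  assumes T: "m \<notin> T" "0 < m"
  shows "(\<Sum>w \<in> signed_lists (insert m T). f w) =
    (\<Sum>w \<in> signed_lists T. (\<Sum>i\<le>length w. f (take i w @ m # drop i w))
       + (\<Sum>i\<le>length w. f (take i w @ (- m) # drop i w)))"
proof -
  let ?P = "\<lambda>x. \<bar>x\<bar> \<noteq> m"
  have "(\<Sum>w \<in> signed_lists (insert m T). f w) =
      (\<Sum>(w, i, s) \<in> signed_lists T \<times> {..card T} \<times> {m, - m}. f (take i w @ s # drop i w))"
  proof (rule sum.reindex_bij_witness[where
        i = "\<lambda>(w, i, s). take i w @ s # drop i w" and
        j = "\<lambda>u. (filter ?P u, length (takeWhile ?P u), hd (dropWhile ?P u))"])
    fix u assume u: "u \<in> signed_lists (insert m T)"
    have "m \<in> abs ` set u" using signed_listsD(2)[OF u] by simp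
    then have "\<exists>x \<in> set u. \<bar>x\<bar> = m" by blast
    then obtain p s q where split: "u = p @ s # q" "\<bar>s\<bar> = m" "\<forall>y \<in> set p. \<bar>y\<bar> \<noteq> m"
      using split_list_first_prop[of u "\<lambda>x. \<bar>x\<bar> = m"] by blast
    have q: "\<forall>y \<in> set q. \<bar>y\<bar> \<noteq> m"
      using signed_listsD(1)[OF u] split by (auto simp: image_iff)
    have fil: "filter ?P u = p @ q" and tw: "takeWhile ?P u = p" and dw: "dropWhile ?P u = s # q"
      using split q by (auto simp: takeWhile_append dropWhile_append)
    show "(case (filter ?P u, length (takeWhile ?P u), hd (dropWhile ?P u)) of
        (w, i, s) \<Rightarrow> take i w @ s # drop i w) = u"
      unfolding fil tw dw using split by simp
    have pq: "p @ q \<in> signed_lists T"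
    proof (rule signed_listsI)
      show "distinct (map abs (p @ q))" using signed_listsD(1)[OF u] split by auto
      have "insert m (abs ` set (p @ q)) = insert m T"
        using signed_listsD(2)[OF u] split by auto
      moreover have "m \<notin> abs ` set (p @ q)" using split q by auto
      ultimately show "abs ` set (p @ q) = T" using T by (metis Diff_insert_absorb)
    qed
    moreover have "s \<in> {m, - m}" using split by auto
    moreover have "length p \<le> card T" using signed_listsD(3)[OF pq] by simp
    ultimately show "(filter ?P u, length (takeWhile ?P u), hd (dropWhile ?P u))
        \<in> signed_lists T \<times> {..card T} \<times> {m, - m}"
      unfolding fil tw dw by simp
    show "(case (filter ?P u, length (takeWhile ?P u), hd (dropWhile ?P u)) of
        (w, i, s) \<Rightarrow> f (take i w @ s # drop i w)) = f u"
      unfolding fil tw dw using split by simp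
  next
    fix a assume "a \<in> signed_lists T \<times> {..card T} \<times> {m, - m}"
    then obtain w i s where a: "a = (w, i, s)" and w: "w \<in> signed_lists T"
      and i: "i \<le> length w" and s: "\<bar>s\<bar> = m"
      using T signed_listsD(3) by (cases a) fastforce
    note sl = signed_listsD[OF w]
    have wm: "\<forall>x \<in> set w. ?P x" using T sl(2) by auto
    have tm: "\<forall>x \<in> set (take i w). ?P x" and dm: "\<forall>x \<in> set (drop i w). ?P x"
      using wm by (auto dest: in_set_takeD in_set_dropD)
    have "filter ?P (take i w) = take i w" "filter ?P (drop i w) = drop i w"
      using tm dm by (simp_all add: filter_id_conv)
    then have "filter ?P (take i w @ s # drop i w) = w"
      using s by simp
    moreover have "takeWhile ?P (take i w @ s # drop i w) = take i w"
      using tm s by (subst takeWhile_append2) auto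
    moreover have "dropWhile ?P (take i w @ s # drop i w) = s # drop i w"
      using tm s by (subst dropWhile_append2) auto
    ultimately show "(\<lambda>u. (filter ?P u, length (takeWhile ?P u), hd (dropWhile ?P u)))
        (case a of (w, i, s) \<Rightarrow> take i w @ s # drop i w) = a"
      using i by (simp add: a)
    have "take i w @ s # drop i w \<in> signed_lists (insert m T)"
    proof (rule signed_listsI)
      have "distinct (map abs (take i w @ drop i w))" using sl(1) by simp
      then show "distinct (map abs (take i w @ s # drop i w))"
        using tm dm s unfolding map_append distinct_append list.map distinct.simps by auto
      have "abs ` set (take i w @ drop i w) = T" using sl(2) by simp
      then show "abs ` set (take i w @ s # drop i w) = insert m T"
        using s by (auto simp del: append_take_drop_id)
    qed
    then show "(case a of (w, i, s) \<Rightarrow> take i w @ s # drop i w) \<in> signed_lists (insert m T)"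
      by (simp add: a)
  qed
  also have "\<dots> = (\<Sum>w \<in> signed_lists T. \<Sum>i\<le>card T. \<Sum>s\<in>{m, - m}. f (take i w @ s # drop i w))"
    by (simp add: sum.cartesian_product)
  also have "\<dots> = (\<Sum>w \<in> signed_lists T. (\<Sum>i\<le>length w. f (take i w @ m # drop i w))
       + (\<Sum>i\<le>length w. f (take i w @ (- m) # drop i w)))"
    using T by (intro sum.cong) (auto simp: signed_listsD(3) sum.distrib)
  finally show ?thesis .
qed

text \<open>
  Each tail has two possible first entries, since only the sign of the missing value is free.
\<close>
lemma sum_signed_lists_tl:
  fixes g :: "int list \<Rightarrow> int"
  assumes T: "finite T" "T \<noteq> {}" "\<forall>x \<in> T. 0 < x"
  shows "(\<Sum>w \<in> signed_lists T. g (tl w)) = 2 * (\<Sum>c \<in> T. \<Sum>v \<in> signed_lists (T - {c}). g v)"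
proof -
  have "(\<Sum>w \<in> signed_lists T. g (tl w)) =
      (\<Sum>(c, v) \<in> Sigma T (\<lambda>c. signed_lists (T - {c})). \<Sum>s\<in>{c, - c}. g v)"
  proof -
    have "(\<Sum>w \<in> signed_lists T. g (tl w)) =
      (\<Sum>((c, v), s) \<in> Sigma (Sigma T (\<lambda>c. signed_lists (T - {c}))) (\<lambda>(c, v). {c, - c}). g v)"
    proof (rule sum.reindex_bij_witness[where
        i = "\<lambda>((c, v), s). s # v" and j = "\<lambda>w. ((\<bar>hd w\<bar>, tl w), hd w)"])
      fix w assume w: "w \<in> signed_lists T"
      then obtain s v where sv: "w = s # v"
        using signed_listsD(2)[OF w] T by (cases w) auto
      have *: "\<bar>s\<bar> \<in> T" "v \<in> signed_lists (T - {\<bar>s\<bar>})" "s \<in> {\<bar>s\<bar>, - \<bar>s\<bar>}"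
        using signed_listsD(1,2)[OF w] by (auto simp: sv image_iff intro!: signed_listsI)
      then show "((\<bar>hd w\<bar>, tl w), hd w) \<in>
          Sigma (Sigma T (\<lambda>c. signed_lists (T - {c}))) (\<lambda>(c, v). {c, - c})"
        by (simp add: sv)
      show "(\<lambda>((c, v), s). s # v) ((\<bar>hd w\<bar>, tl w), hd w) = w"
        by (simp_all add: sv)
      show "(\<lambda>((c, v), s). g v) ((\<bar>hd w\<bar>, tl w), hd w) = g (tl w)"
        by (simp_all add: sv)
    next
      fix a assume "a \<in> Sigma (Sigma T (\<lambda>c. signed_lists (T - {c}))) (\<lambda>(c, v). {c, - c})"
      then obtain c v s where a: "a = ((c, v), s)" "c \<in> T" "v \<in> signed_lists (T - {c})"
        "s \<in> {c, - c}" by auto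
      then have s: "\<bar>s\<bar> = c" using T by auto
      show "(\<lambda>w. ((\<bar>hd w\<bar>, tl w), hd w)) ((\<lambda>((c, v), s). s # v) a) = a"
        using a s by simp
      have "s # v \<in> signed_lists T"
      proof (rule signed_listsI)
        show "distinct (map abs (s # v))" "abs ` set (s # v) = T"
          using signed_listsD(1,2)[OF a(3)] s a(2) by (auto simp: image_iff)
      qed
      then show "((\<lambda>((c, v), s). s # v) a) \<in> signed_lists T"
        by (simp add: a)
    qed
    also have "\<dots> = (\<Sum>(c, v) \<in> Sigma T (\<lambda>c. signed_lists (T - {c})). \<Sum>s\<in>{c, - c}. g v)"
      using T by (subst sum.Sigma[symmetric]) (auto simp: finite_signed_lists split_def intro!: sum.cong)
    finally show ?thesis .
  qed
  also have "\<dots> = (\<Sum>c\<in>T. \<Sum>v \<in> signed_lists (T - {c}). \<Sum>s\<in>{c, - c}. g v)"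
    using T by (subst sum.Sigma) (auto simp: finite_signed_lists)
  also have "\<dots> = (\<Sum>c\<in>T. \<Sum>v \<in> signed_lists (T - {c}). 2 * g v)"
    using T by (intro sum.cong) auto
  finally show ?thesis by (simp add: sum_distrib_left)
qed

section \<open>Two-term recurrences\<close>

fun eulerian_B :: "nat \<Rightarrow> int \<Rightarrow> int" where
  "eulerian_B 0 k = of_bool (k = 0)"
| "eulerian_B (Suc n) k =
     (2 * k + 1) * eulerian_B n k + (2 * int n - 2 * k + 3) * eulerian_B n (k - 1)"

text \<open>
  The classical Eulerian numbers multiplied by \<open>2 ^ n\<close>, one factor for each choice of signs.
\<close>
fun signed_eulerian_A :: "nat \<Rightarrow> int \<Rightarrow> int" where
  "signed_eulerian_A 0 k = of_bool (k = 0)"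
| "signed_eulerian_A (Suc n) k = 2 * (k + 1) * signed_eulerian_A n k
     + 2 * (int n - k + 1) * signed_eulerian_A n (k - 1)"

text \<open>
  The common part of the two insertion arguments: if inserting \<open>m\<close> or \<open>- m\<close> into one fixed list
  redistributes the statistic \<open>\<delta>\<close> with weights \<open>a\<close> and \<open>b\<close>, the same weights relate the totals.
\<close>
lemma sum_signed_lists_recurrence:
  fixes \<delta> :: "int list \<Rightarrow> int" and a b :: int
  assumes T: "\<forall>x \<in> T. 0 < x \<and> x < m" "0 < m"
    and ins: "\<And>w. w \<in> signed_lists T \<Longrightarrow> \<forall>x \<in> set w. x < m \<and> - m < x \<Longrightarrow>
       (\<Sum>i\<le>length w. of_bool (\<delta> (take i w @ m # drop i w) = k))
       + (\<Sum>i\<le>length w. of_bool (\<delta> (take i w @ (- m) # drop i w) = k)) =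
       a * of_bool (\<delta> w = k) + b * of_bool (\<delta> w = k - 1)"
  shows "(\<Sum>w \<in> signed_lists (insert m T). of_bool (\<delta> w = k)) =
    a * (\<Sum>w \<in> signed_lists T. of_bool (\<delta> w = k))
    + b * (\<Sum>w \<in> signed_lists T. of_bool (\<delta> w = k - 1))"
proof -
  have bound: "\<forall>x \<in> set w. x < m \<and> - m < x" if w: "w \<in> signed_lists T" for w
  proof
    fix x assume "x \<in> set w"
    then have "\<bar>x\<bar> \<in> T" using signed_listsD(2)[OF w] by blast
    then show "x < m \<and> - m < x" using T by fastforce
  qed
  have "m \<notin> T" using T by blast
  then show ?thesis
    using T(2) ins[OF _ bound]
    by (simp add: sum_signed_lists_insert sum.distrib flip: sum_distrib_left)
qed

text \<open>
  The prefix \<open>0\<close> is never displaced, so both signs of \<open>m\<close> are inserted behind it, and the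
  weights are the sums of those for a maximal and a minimal entry. The total depends on \<open>T\<close> only through
  its cardinality, because only comparisons of absolute values and signs matter.
\<close>
lemma sum_des_0_signed_lists:
  assumes "finite T" "\<forall>x \<in> T. 0 < x"
  shows "(\<Sum>w \<in> signed_lists T. of_bool (des (0 # w) = k)) = eulerian_B (card T) k"
  using assms
proof (induction T arbitrary: k rule: finite_linorder_max_induct)
  case empty
  then show ?case by (auto simp: signed_lists_empty)
next
  case (insert m T)
  have card: "card (insert m T) = Suc (card T)"
    using insert.hyps by (subst card_insert_disjoint) auto
  have "(\<Sum>w \<in> signed_lists (insert m T). of_bool (des (0 # w) = k)) =
    (2 * k + 1) * (\<Sum>w \<in> signed_lists T. of_bool (des (0 # w) = k))
    + (2 * int (card T) - 2 * k + 3) * (\<Sum>w \<in> signed_lists T. of_bool (des (0 # w) = k - 1))"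
  proof (rule sum_signed_lists_recurrence)
    fix w assume "w \<in> signed_lists T" "\<forall>x \<in> set w. x < m \<and> - m < x"
    then have "0 < m" "\<forall>x \<in> set w. x < m" "\<forall>x \<in> set w. - m < x"
      using insert.prems by auto
    then show "(\<Sum>i\<le>length w. of_bool (des (0 # take i w @ m # drop i w) = k))
       + (\<Sum>i\<le>length w. of_bool (des (0 # take i w @ (- m) # drop i w) = k)) =
       (2 * k + 1) * of_bool (des (0 # w) = k)
       + (2 * int (card T) - 2 * k + 3) * of_bool (des (0 # w) = k - 1)"
      using signed_listsD(3)[OF \<open>w \<in> signed_lists T\<close>]
        sum_insert_greater[of 0 m w k] sum_insert_less[of "- m" 0 w k]
      by (simp del: sum_of_bool_eq)
  qed (use insert in auto)
  then show ?case
    using insert by (simp add: card)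
qed

text \<open>
  Here the new entry may also come first, where \<open>m\<close> adds a descent and \<open>- m\<close> does not. This
  extra position makes the weights for the two signs equal, hence the factor \<open>2\<close>.
\<close>
lemma sum_des_signed_lists:
  assumes "finite T" "\<forall>x \<in> T. 0 < x"
  shows "(\<Sum>w \<in> signed_lists T. of_bool (des w = k)) = signed_eulerian_A (card T) k"
  using assms
proof (induction T arbitrary: k rule: finite_linorder_max_induct)
  case empty
  then show ?case by (auto simp: signed_lists_empty)
next
  case (insert m T)
  have card: "card (insert m T) = Suc (card T)"
    using insert.hyps by (subst card_insert_disjoint) auto
  have "(\<Sum>w \<in> signed_lists (insert m T). of_bool (des w = k)) =
    2 * (k + 1) * (\<Sum>w \<in> signed_lists T. of_bool (des w = k))
    + 2 * (int (card T) - k + 1) * (\<Sum>w \<in> signed_lists T. of_bool (des w = k - 1))"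
  proof (rule sum_signed_lists_recurrence)
    fix w assume w: "w \<in> signed_lists T" and bound: "\<forall>x \<in> set w. x < m \<and> - m < x"
    \<comment> \<open>Insertion in front is split off; the other positions lie behind the first entry \<open>x\<close>.\<close>
    show "(\<Sum>i\<le>length w. of_bool (des (take i w @ m # drop i w) = k))
       + (\<Sum>i\<le>length w. of_bool (des (take i w @ (- m) # drop i w) = k)) =
       2 * (k + 1) * of_bool (des w = k)
       + 2 * (int (card T) - k + 1) * of_bool (des w = k - 1)"
    proof (cases w)
      case Nil
      then show ?thesis using signed_listsD(3)[OF w] by (auto simp: of_bool_def)
    next
      case (Cons x v)
      then have "x < m" "- m < x" "\<forall>y \<in> set v. y < m" "\<forall>y \<in> set v. - m < y"
        using bound by auto
      then show ?thesis
        using Cons signed_listsD(3)[OF w, symmetric]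
          sum_insert_greater[of x m v k] sum_insert_less[of "- m" x v k]
        by (simp add: sum.atMost_Suc_shift del: sum.atMost_Suc)
    qed
  qed (use insert in auto)
  then show ?case
    using insert by (simp add: card)
qed

section \<open>Reduction of type D to type B and type A\<close>

lemma signed_perms_eq: "signed_perms n = signed_lists {1..int n}"
  by (simp add: signed_perms_def signed_lists_def)

lemma card_descents_D:
  assumes "length w \<ge> 2"
  shows "int (card (descents_D w)) = des (- (w ! 1) # w)"
proof -
  have "entry_D w i = (- (w ! 1) # w) ! i" for i
    by (cases i) (auto simp: entry_D_def)
  then have "descents_D w = {i. Suc i < length (- (w ! 1) # w)
      \<and> (- (w ! 1) # w) ! Suc i < (- (w ! 1) # w) ! i}"
    using assms by (simp add: descents_D_def)
  then show ?thesis
    by (simp only: card_descents_eq_des)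
qed

definition flip_one :: "int \<Rightarrow> int" where
  "flip_one x = (if \<bar>x\<bar> = 1 then - x else x)"

lemma abs_flip_one [simp]: "\<bar>flip_one x\<bar> = \<bar>x\<bar>"
  by (simp add: flip_one_def)

lemma flip_one_flip_one [simp]: "flip_one (flip_one x) = x"
  by (simp add: flip_one_def)

lemma flip_one_uminus: "flip_one (- x) = - flip_one x"
  by (simp add: flip_one_def)

text \<open>
  No nonzero integer lies strictly between \<open>-1\<close> and \<open>1\<close>, so exchanging these two values
  changes no comparison other than that of \<open>1\<close> with \<open>-1\<close>.
\<close>
lemma flip_one_less_iff:
  "\<bar>x\<bar> \<noteq> \<bar>y\<bar> \<Longrightarrow> x \<noteq> 0 \<Longrightarrow> y \<noteq> 0 \<Longrightarrow> flip_one x < flip_one y \<longleftrightarrow> x < y"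
  by (auto simp: flip_one_def)

lemma des_map_flip_one:
  "successively (\<lambda>x y. \<bar>x\<bar> \<noteq> \<bar>y\<bar>) xs \<Longrightarrow> 0 \<notin> set xs \<Longrightarrow> des (map flip_one xs) = des xs"
  by (induction xs rule: des.induct) (auto simp: flip_one_less_iff)

lemma bij_betw_flip_one: "bij_betw (map flip_one) (signed_lists T) (signed_lists T)"
proof (rule bij_betw_byWitness[where f' = "map flip_one"])
  show "map flip_one ` signed_lists T \<subseteq> signed_lists T"
    by (auto simp: signed_lists_def comp_def)
  then show "map flip_one ` signed_lists T \<subseteq> signed_lists T" .
qed (auto simp: comp_def)

lemma even_negatives_flip_one:
  assumes w: "w \<in> signed_lists T" and "1 \<in> T"
  shows "even (length (filter (\<lambda>x. x < 0) (map flip_one w)))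
    \<longleftrightarrow> odd (length (filter (\<lambda>x. x < 0) w))"
proof -
  have "1 \<in> abs ` set w" using signed_listsD(2)[OF w] assms(2) by simp
  then have "\<exists>x \<in> set w. \<bar>x\<bar> = 1" by force
  then obtain p s q where split: "w = p @ s # q" "\<bar>s\<bar> = 1" "\<forall>y \<in> set p. \<bar>y\<bar> \<noteq> 1"
    using split_list_first_prop[of w "\<lambda>x. \<bar>x\<bar> = 1"] by blast
  have "\<forall>y \<in> set q. \<bar>y\<bar> \<noteq> 1"
    using signed_listsD(1)[OF w] split by auto
  then have "map flip_one p = p" "map flip_one q = q"
    using split by (auto simp: flip_one_def intro!: map_idI)
  then show ?thesis
    using split(1,2) by (auto simp: flip_one_def)
qed

text \<open>
  Changing the sign of the entry \<open>1\<close> or \<open>-1\<close> is a bijection between the signed permutations with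
  an even and those with an odd number of negative entries, and it preserves the D-descents.
\<close>
lemma two_eulerian_D:
  assumes n: "n \<ge> 2"
  shows "2 * eulerian_D n k = (\<Sum>w \<in> signed_perms n. of_bool (des (- (w ! 1) # w) = k))"
proof -
  let ?S = "signed_perms n" and ?d = "\<lambda>w :: int list. des (- (w ! 1) # w)"
  let ?E = "\<lambda>w :: int list. even (length (filter (\<lambda>x. x < 0) w))"
  have fin: "finite ?S" by (simp add: signed_perms_eq finite_signed_lists)
  have flip: "?d (map flip_one w) = ?d w" "?E (map flip_one w) \<longleftrightarrow> \<not> ?E w" if w: "w \<in> ?S" for w
  proof -
    have w': "w \<in> signed_lists {1..int n}" using w by (simp add: signed_perms_eq)
    note sl = signed_listsD[OF w']
    obtain a b v where abv: "w = a # b # v"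
      using sl(3) n by (cases w; cases "tl w") auto
    have nz: "0 \<notin> set w"
    proof
      assume "0 \<in> set w"
      then have "\<bar>0\<bar> \<in> abs ` set w" by blast
      then show False using sl(2) by simp
    qed
    \<comment> \<open>Prepending \<open>- b\<close> keeps neighbours distinct in absolute value, as the next entry is \<open>a\<close>, not \<open>b\<close>.\<close>
    have "successively (\<noteq>) (map abs w)"
      using sl(1) by (simp add: distinct_adj_altdef remdups_adj_distinct flip: distinct_adj_def)
    then have "successively (\<lambda>x y. \<bar>x\<bar> \<noteq> \<bar>y\<bar>) w"
      by (simp only: successively_map)
    then have "successively (\<lambda>x y. \<bar>x\<bar> \<noteq> \<bar>y\<bar>) (- b # w)"
      by (simp add: abv)
    then have "des (map flip_one (- b # w)) = des (- b # w)"
      using nz by (intro des_map_flip_one) (auto simp: abv)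
    then show "?d (map flip_one w) = ?d w"
      by (simp add: abv flip_one_uminus)
    show "?E (map flip_one w) \<longleftrightarrow> \<not> ?E w"
      using even_negatives_flip_one[OF w'] n by simp
  qed
  have "{w \<in> even_signed_perms n. int (card (descents_D w)) = k} = {w \<in> ?S. ?E w \<and> ?d w = k}"
    using n by (auto simp: even_signed_perms_def length_filter_conv_card card_descents_D
        length_signed_perms)
  then have "eulerian_D n k = (\<Sum>w \<in> ?S. of_bool (?E w \<and> ?d w = k))"
    using n fin by (simp add: eulerian_D_def of_bool_def sum.If_cases Int_def)
  moreover have "(\<Sum>w \<in> ?S. of_bool (?E w \<and> ?d w = k) :: int) =
      (\<Sum>w \<in> ?S. of_bool (\<not> ?E w \<and> ?d w = k))"
  proof -
    have "(\<Sum>w \<in> ?S. of_bool (?E w \<and> ?d w = k) :: int) =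
        (\<Sum>w \<in> ?S. of_bool (?E (map flip_one w) \<and> ?d (map flip_one w) = k))"
      unfolding signed_perms_eq by (rule sum.reindex_bij_betw[OF bij_betw_flip_one, symmetric])
    also have "\<dots> = (\<Sum>w \<in> ?S. of_bool (\<not> ?E w \<and> ?d w = k))"
      by (intro sum.cong) (simp_all only: flip)
    finally show ?thesis .
  qed
  ultimately have "2 * eulerian_D n k =
      (\<Sum>w \<in> ?S. of_bool (?E w \<and> ?d w = k) + of_bool (\<not> ?E w \<and> ?d w = k))"
    by (simp add: sum.distrib)
  also have "\<dots> = (\<Sum>w \<in> ?S. of_bool (?d w = k))"
    by (intro sum.cong) auto
  finally show ?thesis .
qed

definition flip_hd :: "int list \<Rightarrow> int list" where
  "flip_hd w = - hd w # tl w"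

lemma bij_betw_flip_hd:
  assumes "T \<noteq> {}"
  shows "bij_betw flip_hd (signed_lists T) (signed_lists T)"
proof -
  have "w \<noteq> []" if "w \<in> signed_lists T" for w
    using signed_listsD(2)[OF that] assms by auto
  moreover have "flip_hd w \<in> signed_lists T" if "w \<in> signed_lists T" for w
    using calculation[OF that] that by (cases w) (auto simp: signed_lists_def flip_hd_def)
  ultimately show ?thesis
    by (intro bij_betw_byWitness[where f' = flip_hd]) (auto simp: flip_hd_def)
qed

text \<open>
  Only the descents at positions \<open>0\<close> and \<open>1\<close> depend on \<open>a\<close>. Counted there over \<open>a\<close> and \<open>- a\<close>, type B
  and type D give the values \<open>0, 1\<close> and \<open>0, 0\<close> if \<open>\<bar>a\<bar> < b\<close>, the values \<open>1, 2\<close> and \<open>2, 2\<close>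
  if \<open>\<bar>a\<bar> < - b\<close>, and \<open>1, 1\<close> and \<open>1, 1\<close> otherwise. In each case, doubling the type B values
  and cancelling the type D values leaves \<open>1, 1\<close>.
\<close>
lemma descents_flip_hd:
  fixes a b :: int
  assumes "\<bar>a\<bar> \<noteq> \<bar>b\<bar>" "a \<noteq> 0"
  shows "2 * of_bool (des (0 # a # b # v) = k) + 2 * of_bool (des (0 # - a # b # v) = k)
    - (of_bool (des (- b # a # b # v) = k) + of_bool (des (- b # - a # b # v) = k)) =
    (2 * of_bool (des (b # v) = k - 1) :: int)"
  using assms by (auto simp: of_bool_def)

lemma eulerian_D_eq_if_ge_2:
  assumes n: "n \<ge> 2"
  shows "eulerian_D n k = eulerian_B n k - int n * signed_eulerian_A (n - 1) (k - 1)"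
proof -
  let ?S = "signed_lists {1..int n}"
  let ?g = "\<lambda>w :: int list. 2 * of_bool (des (0 # w) = k) - of_bool (des (- (w ! 1) # w) = k) :: int"
  have "(\<Sum>w \<in> ?S. ?g w) = (\<Sum>w \<in> ?S. ?g (flip_hd w))"
    using n by (intro sum.reindex_bij_betw[OF bij_betw_flip_hd, symmetric]) auto
  then have "2 * (\<Sum>w \<in> ?S. ?g w) = (\<Sum>w \<in> ?S. ?g w + ?g (flip_hd w))"
    by (simp only: sum.distrib)
  also have "\<dots> = (\<Sum>w \<in> ?S. 2 * of_bool (des (tl w) = k - 1))"
  proof (intro sum.cong refl)
    fix w assume w: "w \<in> ?S"
    note sl = signed_listsD[OF w]
    obtain a b v where abv: "w = a # b # v"
      using sl(3) n by (cases w; cases "tl w") auto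
    have "\<bar>a\<bar> \<in> {1..int n}" using sl(2) by (auto simp: abv)
    then have "a \<noteq> 0" "\<bar>a\<bar> \<noteq> \<bar>b\<bar>" using sl(1) by (auto simp: abv)
    then show "?g w + ?g (flip_hd w) = 2 * of_bool (des (tl w) = k - 1)"
      using descents_flip_hd[of a b v k] by (simp add: abv flip_hd_def del: des.simps)
  qed
  finally have "(\<Sum>w \<in> ?S. ?g w) = (\<Sum>w \<in> ?S. of_bool (des (tl w) = k - 1))"
    by (simp flip: sum_distrib_left)
  also have "\<dots> = 2 * (\<Sum>c \<in> {1..int n}. \<Sum>v \<in> signed_lists ({1..int n} - {c}). of_bool (des v = k - 1))"
    using n by (subst sum_signed_lists_tl) auto
  also have "\<dots> = 2 * (\<Sum>c \<in> {1..int n}. signed_eulerian_A (n - 1) (k - 1))"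
  proof -
    have "(\<Sum>v \<in> signed_lists ({1..int n} - {c}). of_bool (des v = k - 1)) =
        signed_eulerian_A (n - 1) (k - 1)" if "c \<in> {1..int n}" for c
      using that by (subst sum_des_signed_lists) (auto simp: card_Diff_singleton)
    then show ?thesis by simp
  qed
  finally have "2 * (\<Sum>w \<in> ?S. of_bool (des (0 # w) = k)) - 2 * eulerian_D n k =
      2 * (int n * signed_eulerian_A (n - 1) (k - 1))"
    using two_eulerian_D[OF n, of k]
    by (simp add: signed_perms_eq sum_subtractf flip: sum_distrib_left)
  then show ?thesis
    by (subst (asm) sum_des_0_signed_lists) auto
qed

text \<open>
  The convention \<open>D\<^sub>0 = D\<^sub>1 = 1\<close> is the one for which Stembridge's identity extends to
  \<open>n < 2\<close>. For \<open>n = 0\<close> the truncated index \<open>n - 1\<close> is harmless because of the factor \<open>n\<close>.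
\<close>
lemma eulerian_D_eq: "eulerian_D n k = eulerian_B n k - int n * signed_eulerian_A (n - 1) (k - 1)"
proof (cases "n \<ge> 2")
  case True
  then show ?thesis by (rule eulerian_D_eq_if_ge_2)
next
  case False
  then have "n = 0 \<or> n = 1" by auto
  then show ?thesis by (auto simp: eulerian_D_def)
qed

section \<open>The recurrence\<close>

text \<open>
  The right-hand side of the recurrence as a linear operator on a family of numbers, so that it can be
  applied to each summand of Stembridge's identity.
\<close>
definition recurrence_rhs :: "(nat \<Rightarrow> int \<Rightarrow> int) \<Rightarrow> nat \<Rightarrow> int \<Rightarrow> int" where
  "recurrence_rhs X n k =
      (int n + 4 * k) * X (n + 1) k
    + (5 * int n - 4 * k + 8) * X (n + 1) (k - 1)
    + ((1 - int n) - 4 * (1 + int n) * k - 4 * k * (k - 1)) * X n k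
    + (- 2 * (1 + int n + 2 * (int n)^2) + 8 * (1 - int n) * (k - 1)
        + 8 * (k - 1) * (k - 2)) * X n (k - 1)
    + ((1 - int n - 8 * (int n)^2) - 4 * (1 - 3 * int n) * (k - 2)
        - 4 * (k - 2) * (k - 3)) * X n (k - 2)
    + (6 * int n * k + 4 * int n * k * (k - 1)) * X (n - 1) k
    + (6 * int n * (int n - 1) + 2 * int n * (4 * int n - 9) * (k - 1)
        - 4 * int n * (k - 1) * (k - 2)) * X (n - 1) (k - 1)
    + (4 * int n * (int n - 1)^2 + 2 * int n * (k - 2)
        - 4 * int n * (k - 2) * (k - 3)) * X (n - 1) (k - 2)
    + (2 * int n * (1 - 3 * int n + 2 * (int n)^2) + 2 * int n * (5 - 4 * int n) * (k - 3)
        + 4 * int n * (k - 3) * (k - 4)) * X (n - 1) (k - 3)"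

text \<open>
  Unfolding the two-term recurrence down to level \<open>n - 1\<close> leaves an identity that holds for each
  coefficient of \<open>eulerian_B (n - 1) (k - j)\<close> with \<open>j \<le> 3\<close>.
\<close>
lemma eulerian_B_recurrence:
  assumes "n \<ge> 1"
  shows "eulerian_B (n + 2) k = recurrence_rhs eulerian_B n k"
proof -
  obtain m where "n = Suc m" using assms by (cases n) auto
  then show ?thesis
    by (simp add: recurrence_rhs_def algebra_simps power2_eq_square)
qed

text \<open>
  The same comparison of coefficients works here at level \<open>n - 2\<close>. For \<open>n = 1\<close> this level does not
  exist, and the finitely many nonzero values are compared directly.
\<close>
lemma signed_eulerian_A_recurrence:
  assumes "n \<ge> 1"
  defines "X \<equiv> \<lambda>n k. int n * signed_eulerian_A (n - 1) (k - 1)"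
  shows "X (n + 2) k = recurrence_rhs X n k"
proof (cases "n = 1")
  case True
  consider "k = 1" | "k = 2" | "k = 3" | "k = 4" | "k \<notin> {1,2,3,4}" by blast
  then show ?thesis
    by cases (auto simp: True X_def recurrence_rhs_def numeral_eq_Suc)
next
  case False
  then obtain m where "n = Suc (Suc m)" using assms by (cases n; cases "n - 1") auto
  then show ?thesis
    by (simp add: recurrence_rhs_def X_def algebra_simps power2_eq_square)
qed

theorem corollary5p4:
  fixes n :: nat and k :: int
  assumes "n \<ge> 1" and "k \<ge> 0"
  shows "eulerian_D (n + 2) k =
      (int n + 4 * k) * eulerian_D (n + 1) k
    + (5 * int n - 4 * k + 8) * eulerian_D (n + 1) (k - 1)
    + ((1 - int n) - 4 * (1 + int n) * k - 4 * k * (k - 1)) * eulerian_D n k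
    + (- 2 * (1 + int n + 2 * (int n)^2) + 8 * (1 - int n) * (k - 1)
        + 8 * (k - 1) * (k - 2)) * eulerian_D n (k - 1)
    + ((1 - int n - 8 * (int n)^2) - 4 * (1 - 3 * int n) * (k - 2)
        - 4 * (k - 2) * (k - 3)) * eulerian_D n (k - 2)
    + (6 * int n * k + 4 * int n * k * (k - 1)) * eulerian_D (n - 1) k
    + (6 * int n * (int n - 1) + 2 * int n * (4 * int n - 9) * (k - 1)
        - 4 * int n * (k - 1) * (k - 2)) * eulerian_D (n - 1) (k - 1)
    + (4 * int n * (int n - 1)^2 + 2 * int n * (k - 2)
        - 4 * int n * (k - 2) * (k - 3)) * eulerian_D (n - 1) (k - 2)
    + (2 * int n * (1 - 3 * int n + 2 * (int n)^2) + 2 * int n * (5 - 4 * int n) * (k - 3)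
        + 4 * int n * (k - 3) * (k - 4)) * eulerian_D (n - 1) (k - 3)"
proof -
  let ?A = "\<lambda>n k. int n * signed_eulerian_A (n - 1) (k - 1)"
  have D: "eulerian_D = (\<lambda>n k. eulerian_B n k - ?A n k)"
    by (intro ext) (rule eulerian_D_eq)
  have "eulerian_D (n + 2) k = recurrence_rhs eulerian_B n k - recurrence_rhs ?A n k"
    using eulerian_B_recurrence[OF assms(1)] signed_eulerian_A_recurrence[OF assms(1)]
    by (simp add: D)
  also have "\<dots> = recurrence_rhs eulerian_D n k"
    unfolding D recurrence_rhs_def by (simp only: right_diff_distrib)
  finally show ?thesis
    unfolding recurrence_rhs_def .
qed

end
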